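(* Suppose $\mu$ has no atoms. Then for every bounded operator $W$ on $\mathcal H$ and every compact operator $W_0$ on $\mathcal H$, $\|W+W_0\|_\mu=\|W\|_\mu$.
   Context: $(\mathcal X,\mathcal B,\mu)$ is a probability measure space and $\mathcal H=L^2(\mathcal X,\mu)$ (complex-valued). The measure $\mu$ has no atoms if for every $X\in\mathcal B$ with $\mu(X)>0$ there is $Y\in\mathcal B$, $Y\subset X$, with $0<\mu(Y)<\mu(X)$. For $X\in\mathcal B$, $\pi_X:\mathcal H\to\mathcal H$ is the orthogonal projector $\pi_Xf=\mathbf 1_X f$. A partition is a finite family $\chi=\{Y_1,\dots,Y_J\}\subset\mathcal B$ with $\mu(\mathcal X\setminus\bigcup_j Y_j)=0$ and $\mu(Y_j\cap Y_k)=0$ for $j\ne k$. For a bounded operator $W$ on $\mathcal H$ with operator norm $\|W\|$, put $\mathcal M_\chi(W)=\sum_{j=1}^J\mu(Y_j)\|W\pi_{Y_j}\|^2$, and define the $\mu$-norm $\|W\|_\mu=\inf_\chi\sqrt{\mathcal M_\chi(W)}$, the infimum being over all partitions $\chi$. *)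

theory Defs
  imports "HOL-Probability.Probability"
begin

text \<open>
  Elements of the Hilbert space \<open>L\<^sup>2(M)\<close> are represented by square-integrable functions, with
  equality in \<open>L\<^sup>2(M)\<close> being equality almost everywhere. An operator on \<open>L\<^sup>2(M)\<close> is accordingly
  represented by a map on functions that is linear up to almost-everywhere equality.
\<close>

definition L2 :: "'a measure \<Rightarrow> ('a \<Rightarrow> complex) set" where
  "L2 M = {f \<in> borel_measurable M. integrable M (\<lambda>x. (cmod (f x))\<^sup>2)}"

definition L2_norm :: "'a measure \<Rightarrow> ('a \<Rightarrow> complex) \<Rightarrow> real" where
  "L2_norm M f = sqrt (\<integral>x. (cmod (f x))\<^sup>2 \<partial>M)"

type_synonym 'a fun_op = "('a \<Rightarrow> complex) \<Rightarrow> ('a \<Rightarrow> complex)"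

definition linear_op :: "'a measure \<Rightarrow> 'a fun_op \<Rightarrow> bool" where
  "linear_op M W \<longleftrightarrow>
     (\<forall>f\<in>L2 M. W f \<in> L2 M) \<and>
     (\<forall>f\<in>L2 M. \<forall>g\<in>L2 M. AE x in M. W (\<lambda>y. f y + g y) x = W f x + W g x) \<and>
     (\<forall>c. \<forall>f\<in>L2 M. AE x in M. W (\<lambda>y. c * f y) x = c * W f x)"

text \<open>
  The norm bound forces a bounded operator to respect almost-everywhere equality
  (see \<open>bounded_op_cong_AE\<close>), so that it acts on the classes.
\<close>

definition bounded_op :: "'a measure \<Rightarrow> 'a fun_op \<Rightarrow> bool" where
  "bounded_op M W \<longleftrightarrow>
     linear_op M W \<and> (\<exists>K. \<forall>f\<in>L2 M. L2_norm M (W f) \<le> K * L2_norm M f)"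

definition compact_op :: "'a measure \<Rightarrow> 'a fun_op \<Rightarrow> bool" where
  "compact_op M W \<longleftrightarrow>
     bounded_op M W \<and>
     (\<forall>f :: nat \<Rightarrow> 'a \<Rightarrow> complex.
        (\<forall>n. f n \<in> L2 M) \<and> (\<exists>C. \<forall>n. L2_norm M (f n) \<le> C) \<longrightarrow>
        (\<exists>r :: nat \<Rightarrow> nat. \<exists>g\<in>L2 M. strict_mono r \<and>
           (\<lambda>n. L2_norm M (\<lambda>x. W (f (r n)) x - g x)) \<longlonglongrightarrow> 0))"

text \<open>The supremum is taken in \<open>real\<close> and is meaningful only for bounded operators.\<close>

definition op_norm :: "'a measure \<Rightarrow> 'a fun_op \<Rightarrow> real" where
  "op_norm M W = (SUP f\<in>{f \<in> L2 M. L2_norm M f \<le> 1}. L2_norm M (W f))"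

definition op_plus :: "'a fun_op \<Rightarrow> 'a fun_op \<Rightarrow> 'a fun_op" where
  "op_plus V W = (\<lambda>f x. V f x + W f x)"

definition proj :: "'a set \<Rightarrow> 'a fun_op" where
  "proj X = (\<lambda>f x. indicator X x * f x)"

definition no_atoms :: "'a measure \<Rightarrow> bool" where
  "no_atoms M \<longleftrightarrow>
     (\<forall>X\<in>sets M. measure M X > 0 \<longrightarrow>
        (\<exists>Y\<in>sets M. Y \<subseteq> X \<and> 0 < measure M Y \<and> measure M Y < measure M X))"

definition is_partition :: "'a measure \<Rightarrow> nat \<Rightarrow> (nat \<Rightarrow> 'a set) \<Rightarrow> bool" where
  "is_partition M J Y \<longleftrightarrow>
     (\<forall>j\<in>{1..J}. Y j \<in> sets M) \<and>
     measure M (space M - (\<Union>j\<in>{1..J}. Y j)) = 0 \<and>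
     (\<forall>j\<in>{1..J}. \<forall>k\<in>{1..J}. j \<noteq> k \<longrightarrow> measure M (Y j \<inter> Y k) = 0)"

definition partition_sum :: "'a measure \<Rightarrow> nat \<Rightarrow> (nat \<Rightarrow> 'a set) \<Rightarrow> 'a fun_op \<Rightarrow> real" where
  "partition_sum M J Y W = (\<Sum>j=1..J. measure M (Y j) * (op_norm M (W \<circ> proj (Y j)))\<^sup>2)"

definition mu_norm :: "'a measure \<Rightarrow> 'a fun_op \<Rightarrow> real" where
  "mu_norm M W = Inf {sqrt (partition_sum M J Y W) | J Y. is_partition M J Y}"

lemma bounded_op_cong_AE:
  assumes W: "bounded_op M W" and f: "f \<in> L2 M" and g: "g \<in> L2 M"
    and eq: "AE x in M. f x = g x"
  shows "AE x in M. W f x = W g x"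
proof -
  define h where "h = (\<lambda>x. f x - g x)"
  have [measurable]: "f \<in> borel_measurable M" "g \<in> borel_measurable M"
    using f g by (auto simp: L2_def)
  have hm [measurable]: "h \<in> borel_measurable M" unfolding h_def by measurable
  have ae: "AE x in M. (cmod (h x))\<^sup>2 = 0" using eq by eventually_elim (simp add: h_def)
  have "integrable M (\<lambda>x. (cmod (h x))\<^sup>2) \<longleftrightarrow> integrable M (\<lambda>x. 0 :: real)"
    by (rule integrable_cong_AE) (use ae in auto)
  then have hL: "h \<in> L2 M" by (simp add: L2_def hm)
  have "(\<integral>x. (cmod (h x))\<^sup>2 \<partial>M) = (\<integral>x. 0 \<partial>M)"
    by (rule integral_cong_AE) (use ae in auto)
  then have h0: "L2_norm M h = 0" by (simp add: L2_norm_def)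
  obtain K where "L2_norm M (W h) \<le> K * L2_norm M h"
    using W hL unfolding bounded_op_def by blast
  then have le: "(\<integral>x. (cmod (W h x))\<^sup>2 \<partial>M) \<le> 0" by (simp add: h0) (simp add: L2_norm_def)
  have "W h \<in> L2 M" using W hL by (simp add: bounded_op_def linear_op_def)
  then have int: "integrable M (\<lambda>x. (cmod (W h x))\<^sup>2)" by (simp add: L2_def)
  have "(\<integral>x. (cmod (W h x))\<^sup>2 \<partial>M) = 0"
    using le by (intro antisym) auto
  then have "AE x in M. (cmod (W h x))\<^sup>2 = 0"
    using integral_nonneg_eq_0_iff_AE[OF int] by simp
  moreover have "AE x in M. W (\<lambda>y. g y + h y) x = W g x + W h x"
    using W g hL by (simp add: bounded_op_def linear_op_def)
  moreover have "(\<lambda>y. g y + h y) = f" by (simp add: h_def)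
  ultimately show ?thesis by auto
qed

end

theory Submission
  imports Defs "HOL-Real_Asymp.Real_Asymp"
begin

text \<open>It suffices to show \<open>mu_norm M (op_plus W V) \<le> mu_norm M W\<close> for bounded
  \<open>W\<close> and compact \<open>V\<close> (\<open>mu_norm_op_plus_compact_le\<close>): applied
  to the operator W + W_0 and the compact operator -W_0, this gives the reverse inequality.

  Two facts carry it. A compact operator is small on small sets: for every e > 0 there is d > 0 such
  that V pi_X has norm at most e whenever mu(X) < d (\<open>compact_op_small_sets\<close>). Indeed,
  vectors of norm at most 1 supported on sets whose measure tends to 0 converge weakly to 0. If
  their images stayed large, a subsequence of the images would converge to some nonzero g, and a sum
  of N nearly orthogonal such vectors would have norm of order sqrt N but an image of norm of order
  N, against boundedness. The absence of atoms, in turn, splits the space into finitely many sets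
  B_k of measure less than d (\<open>no_atoms_partition\<close>).

  Cut a given partition Y_j by such sets B_k. With a_j the norm of W pi_{Y_j}, the norm of W + V on
  each piece of Y_j is at most a_j + e, and the measures of these pieces add up to mu(Y_j). So the
  mu-norm of W + V is at most the square root of the sum of mu(Y_j) (a_j + e)^2, where the cut no
  longer appears. Letting e tend to 0 and taking the infimum over partitions finishes the
  proof.\<close>

section \<open>Inner product, norm and projections on square-integrable functions\<close>

lemma L2_measurable: "f \<in> L2 M \<Longrightarrow> f \<in> borel_measurable M"
  and L2_integrable: "f \<in> L2 M \<Longrightarrow> integrable M (\<lambda>x. (cmod (f x))\<^sup>2)"
  by (auto simp: L2_def)

lemma L2_zero: "(\<lambda>x. 0) \<in> L2 M"
  by (simp add: L2_def)

lemma L2_norm_zero: "L2_norm M (\<lambda>x. 0) = 0"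
  by (simp add: L2_norm_def)

lemma L2_norm_nonneg: "0 \<le> L2_norm M f"
  by (simp add: L2_norm_def)

lemma L2_norm_power2: "(L2_norm M f)\<^sup>2 = (\<integral>x. (cmod (f x))\<^sup>2 \<partial>M)"
  by (simp add: L2_norm_def)

lemma L2_norm_uminus: "L2_norm M (\<lambda>x. - f x) = L2_norm M f"
  by (simp add: L2_norm_def)

lemma L2_norm_minus_commute: "L2_norm M (\<lambda>x. f x - g x) = L2_norm M (\<lambda>x. g x - f x)"
  by (simp add: L2_norm_def norm_minus_commute)

lemma L2_norm_cong_AE:
  assumes "f \<in> L2 M" "g \<in> L2 M" "AE x in M. f x = g x"
  shows "L2_norm M f = L2_norm M g"
proof -
  have [measurable]: "f \<in> borel_measurable M" "g \<in> borel_measurable M"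
    using assms by (auto dest: L2_measurable)
  have "(\<integral>x. (cmod (f x))\<^sup>2 \<partial>M) = (\<integral>x. (cmod (g x))\<^sup>2 \<partial>M)"
    by (rule integral_cong_AE) (use assms(3) in auto)
  then show ?thesis by (simp add: L2_norm_def)
qed

text \<open>On complex numbers \<open>inner\<close> is the real part of the Hermitian product. This
  real inner product already determines the norm, and no complex one is introduced.\<close>

lemma L2_inner_integrable:
  assumes "f \<in> L2 M" "g \<in> L2 M"
  shows "integrable M (\<lambda>x. inner (f x) (g x))"
proof (rule Bochner_Integration.integrable_bound)
  show "integrable M (\<lambda>x. (cmod (f x))\<^sup>2 + (cmod (g x))\<^sup>2)"
    using assms by (intro Bochner_Integration.integrable_add L2_integrable)
  show "(\<lambda>x. inner (f x) (g x)) \<in> borel_measurable M"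
    using assms by (intro borel_measurable_inner L2_measurable)
  have "\<bar>inner (f x) (g x)\<bar> \<le> (cmod (f x))\<^sup>2 + (cmod (g x))\<^sup>2" for x
  proof -
    have "\<bar>inner (f x) (g x)\<bar> \<le> cmod (f x) * cmod (g x)"
      by (rule Cauchy_Schwarz_ineq2)
    also have "\<dots> \<le> 2 * (cmod (f x) * cmod (g x))" by simp
    also have "\<dots> \<le> (cmod (f x))\<^sup>2 + (cmod (g x))\<^sup>2"
      using sum_squares_bound[of "cmod (f x)" "cmod (g x)"] by simp
    finally show ?thesis .
  qed
  then show "AE x in M. norm (inner (f x) (g x)) \<le> norm ((cmod (f x))\<^sup>2 + (cmod (g x))\<^sup>2)"
    by simp
qed

text \<open>One expansion of the square serves many purposes: closure of \<open>L2 M\<close> under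
  sums, differences and real multiples, the quadratic polynomial behind Cauchy-Schwarz, the triangle
  inequality, and the growth of norms in \<open>compact_op_small_sets\<close>.\<close>

lemma L2_add_scale:
  fixes f g :: "'a \<Rightarrow> complex" and c :: real
  assumes f: "f \<in> L2 M" and g: "g \<in> L2 M"
  shows "(\<lambda>x. f x + c * g x) \<in> L2 M"
    and "(L2_norm M (\<lambda>x. f x + c * g x))\<^sup>2
      = (L2_norm M f)\<^sup>2 + 2 * c * (\<integral>x. inner (f x) (g x) \<partial>M) + c\<^sup>2 * (L2_norm M g)\<^sup>2"
proof -
  have eq: "(cmod (f x + c * g x))\<^sup>2
      = (cmod (f x))\<^sup>2 + (2 * c) * inner (f x) (g x) + c\<^sup>2 * (cmod (g x))\<^sup>2" for x
    by (simp only: cmod_power2 inner_complex_def)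
       (simp add: power2_eq_square algebra_simps)
  note [simp] = L2_integrable[OF f] L2_integrable[OF g] L2_inner_integrable[OF f g]
  have "integrable M (\<lambda>x. (cmod (f x + c * g x))\<^sup>2)"
    unfolding eq by (intro Bochner_Integration.integrable_add integrable_mult_right) auto
  then show "(\<lambda>x. f x + c * g x) \<in> L2 M"
    using L2_measurable[OF f] L2_measurable[OF g] by (simp add: L2_def)
  show "(L2_norm M (\<lambda>x. f x + c * g x))\<^sup>2
      = (L2_norm M f)\<^sup>2 + 2 * c * (\<integral>x. inner (f x) (g x) \<partial>M) + c\<^sup>2 * (L2_norm M g)\<^sup>2"
    unfolding L2_norm_power2 eq by simp
qed

lemma L2_add: "f \<in> L2 M \<Longrightarrow> g \<in> L2 M \<Longrightarrow> (\<lambda>x. f x + g x) \<in> L2 M"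
  using L2_add_scale(1)[of f M g 1] by simp

lemma L2_diff: "f \<in> L2 M \<Longrightarrow> g \<in> L2 M \<Longrightarrow> (\<lambda>x. f x - g x) \<in> L2 M"
  using L2_add_scale(1)[of f M g "-1"] by simp

lemma L2_uminus: "f \<in> L2 M \<Longrightarrow> (\<lambda>x. - f x) \<in> L2 M"
  by (simp add: L2_def)

lemma L2_scale: "f \<in> L2 M \<Longrightarrow> (\<lambda>x. of_real c * f x) \<in> L2 M"
  using L2_add_scale(1)[OF L2_zero, where g = f and c = c] by simp

lemma L2_norm_scale: "L2_norm M (\<lambda>x. of_real c * f x) = \<bar>c\<bar> * L2_norm M f"
  by (simp add: L2_norm_def norm_mult power_mult_distrib real_sqrt_mult)

text \<open>The squared norm of f + c g is a quadratic polynomial in the real number c that is never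
  negative.\<close>

lemma L2_Cauchy_Schwarz:
  assumes f: "f \<in> L2 M" and g: "g \<in> L2 M"
  shows "\<bar>\<integral>x. inner (f x) (g x) \<partial>M\<bar> \<le> L2_norm M f * L2_norm M g"
proof -
  define A B p where "A = (L2_norm M f)\<^sup>2" and "B = (L2_norm M g)\<^sup>2"
    and "p = (\<integral>x. inner (f x) (g x) \<partial>M)"
  have q: "0 \<le> A + 2 * c * p + c\<^sup>2 * B" for c
    using L2_add_scale(2)[OF f g, of c] by (metis A_def B_def p_def zero_le_power2)
  have "p\<^sup>2 \<le> A * B"
  proof (cases "B = 0")
    case True
    have "p = 0"
    proof (rule ccontr)
      assume "p \<noteq> 0"
      \<comment> \<open>With \<open>B = 0\<close> the polynomial is affine in c; at this c its value
        is A - 2 (A + 1) = - A - 2, which is negative.\<close>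
      then show False
        using q[of "- (A + 1) / p"] True zero_le_power2[of "L2_norm M f"]
        by (simp add: A_def)
    qed
    then show ?thesis using True by simp
  next
    case False
    then have "B > 0" by (simp add: B_def)
    \<comment> \<open>The value \<open>c = - p / B\<close> minimises the polynomial.\<close>
    have "0 \<le> A + 2 * (- p / B) * p + (- p / B)\<^sup>2 * B" by (rule q)
    also have "\<dots> = A - p\<^sup>2 / B"
      using False by (simp add: power2_eq_square)
    finally show ?thesis using \<open>B > 0\<close> by (simp add: divide_simps)
  qed
  then have "\<bar>p\<bar>\<^sup>2 \<le> (L2_norm M f * L2_norm M g)\<^sup>2"
    by (simp add: A_def B_def power_mult_distrib)
  then have "\<bar>p\<bar> \<le> L2_norm M f * L2_norm M g"
    by (rule power2_le_imp_le) (simp add: L2_norm_nonneg)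
  then show ?thesis
    unfolding p_def .
qed

lemma L2_triangle:
  assumes f: "f \<in> L2 M" and g: "g \<in> L2 M"
  shows "L2_norm M (\<lambda>x. f x + g x) \<le> L2_norm M f + L2_norm M g"
proof (rule power2_le_imp_le)
  have "(L2_norm M (\<lambda>x. f x + g x))\<^sup>2
      = (L2_norm M f)\<^sup>2 + 2 * (\<integral>x. inner (f x) (g x) \<partial>M) + (L2_norm M g)\<^sup>2"
    using L2_add_scale(2)[OF f g, of 1] by simp
  also have "\<dots> \<le> (L2_norm M f + L2_norm M g)\<^sup>2"
    using L2_Cauchy_Schwarz[OF f g] by (simp add: power2_sum)
  finally show "(L2_norm M (\<lambda>x. f x + g x))\<^sup>2 \<le> (L2_norm M f + L2_norm M g)\<^sup>2" .
qed (simp add: L2_norm_nonneg)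

lemma L2_triangle_diff:
  assumes "f \<in> L2 M" "g \<in> L2 M"
  shows "L2_norm M f \<le> L2_norm M (\<lambda>x. f x - g x) + L2_norm M g"
  using L2_triangle[OF L2_diff[OF assms] assms(2)] by simp

lemma
  assumes f: "f \<in> L2 M" and X: "X \<in> sets M"
  shows L2_proj: "proj X f \<in> L2 M"
    and L2_norm_proj_le: "L2_norm M (proj X f) \<le> L2_norm M f"
    and L2_norm_proj: "(L2_norm M (proj X f))\<^sup>2 = (\<integral>x. indicator X x * (cmod (f x))\<^sup>2 \<partial>M)"
proof -
  have [measurable]: "f \<in> borel_measurable M" "X \<in> sets M"
    using f X by (auto dest: L2_measurable)
  have eq: "(cmod (proj X f x))\<^sup>2 = indicator X x * (cmod (f x))\<^sup>2" for x
    by (simp add: proj_def norm_mult indicator_def)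
  have int: "integrable M (\<lambda>x. indicator X x * (cmod (f x))\<^sup>2)"
    using integrable_real_mult_indicator[OF X L2_integrable[OF f]] by (simp add: mult.commute)
  have "proj X f \<in> borel_measurable M" by (simp add: proj_def)
  then show "proj X f \<in> L2 M" using int by (simp add: L2_def eq)
  show "(L2_norm M (proj X f))\<^sup>2 = (\<integral>x. indicator X x * (cmod (f x))\<^sup>2 \<partial>M)"
    by (simp add: L2_norm_power2 eq)
  have "(\<integral>x. indicator X x * (cmod (f x))\<^sup>2 \<partial>M) \<le> (\<integral>x. (cmod (f x))\<^sup>2 \<partial>M)"
    by (intro integral_mono int L2_integrable[OF f]) (auto simp: indicator_def)
  then show "L2_norm M (proj X f) \<le> L2_norm M f"
    by (simp add: L2_norm_def eq)
qed

section \<open>Sets of small measure and weak convergence\<close>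

text \<open>Absolute continuity of the integral, for sets that need not be nested. Since f is at
  most k + max 0 (f - k), the integral over \<open>X n\<close> is at most k times the measure of
  \<open>X n\<close> plus a tail. The tail is small for large k by dominated convergence; for that
  fixed k the other term tends to 0.\<close>

lemma (in finite_measure) integral_indicator_tendsto_0:
  fixes f :: "'a \<Rightarrow> real"
  assumes f: "integrable M f" and nonneg: "\<And>x. 0 \<le> f x"
    and X: "\<And>n. X n \<in> sets M" and lim: "(\<lambda>n. measure M (X n)) \<longlonglongrightarrow> 0"
  shows "(\<lambda>n. \<integral>x. indicator (X n) x * f x \<partial>M) \<longlonglongrightarrow> 0"
proof -
  have [measurable]: "f \<in> borel_measurable M" using f by simp
  note [measurable] = X
  have tail: "(\<lambda>k. \<integral>x. max 0 (f x - real k) \<partial>M) \<longlonglongrightarrow> (\<integral>x. 0 \<partial>M)"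
  proof (rule integral_dominated_convergence[OF _ _ f])
    have "(\<lambda>k. max 0 (f x - real k)) \<longlonglongrightarrow> 0" for x
    proof (rule tendsto_eventually)
      have "eventually (\<lambda>k. f x \<le> real k) sequentially" by real_asymp
      then show "eventually (\<lambda>k. max 0 (f x - real k) = 0) sequentially"
        by eventually_elim simp
    qed
    then show "AE x in M. (\<lambda>k. max 0 (f x - real k)) \<longlonglongrightarrow> 0" by simp
  qed (use nonneg in auto)
  show ?thesis
  proof (rule LIMSEQ_I)
    fix e :: real assume "0 < e"
    then have "eventually (\<lambda>k. (\<integral>x. max 0 (f x - real k) \<partial>M) < e / 2) sequentially"
      using tail by (intro order_tendstoD) auto
    then obtain k where k: "(\<integral>x. max 0 (f x - real k) \<partial>M) < e / 2"
      by (auto simp: eventually_sequentially)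
    have "(\<lambda>n. real k * measure M (X n)) \<longlonglongrightarrow> real k * 0"
      by (intro tendsto_intros lim)
    then have "eventually (\<lambda>n. real k * measure M (X n) < e / 2) sequentially"
      using \<open>0 < e\<close> by (intro order_tendstoD) auto
    then obtain n0 where n0: "\<And>n. n \<ge> n0 \<Longrightarrow> real k * measure M (X n) < e / 2"
      by (auto simp: eventually_sequentially)
    have "norm ((\<integral>x. indicator (X n) x * f x \<partial>M) - 0) < e" if "n \<ge> n0" for n
    proof -
      have i1: "integrable M (\<lambda>x. indicator (X n) x * f x)"
        using integrable_real_mult_indicator[OF X f] by (simp add: mult.commute)
      have i2: "integrable M (\<lambda>x. max 0 (f x - real k))"
        by (rule Bochner_Integration.integrable_bound[OF f]) (use nonneg in auto)
      have i3: "integrable M (\<lambda>x. real k * indicator (X n) x)"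
        by (intro integrable_mult_right) (simp add: emeasure_eq_measure)
      have "(\<integral>x. indicator (X n) x * f x \<partial>M)
          \<le> (\<integral>x. real k * indicator (X n) x + max 0 (f x - real k) \<partial>M)"
        by (intro integral_mono i1 Bochner_Integration.integrable_add i2 i3) (auto simp: indicator_def)
      also have "\<dots> = real k * measure M (X n) + (\<integral>x. max 0 (f x - real k) \<partial>M)"
        using i2 i3 sets.sets_into_space[OF X] by (simp add: Int_absorb2)
      also have "\<dots> < e" using k n0[OF that] by simp
      finally have "(\<integral>x. indicator (X n) x * f x \<partial>M) < e" .
      moreover have "0 \<le> (\<integral>x. indicator (X n) x * f x \<partial>M)"
        by (intro Bochner_Integration.integral_nonneg) (simp add: nonneg)
      ultimately show ?thesis by simp
    qed
    then show "\<exists>n0. \<forall>n\<ge>n0. norm ((\<integral>x. indicator (X n) x * f x \<partial>M) - 0) < e" by blast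
  qed
qed

text \<open>The projection is self-adjoint and can be moved onto the fixed vector \<open>s\<close>.
  Cauchy-Schwarz then leaves the norm of \<open>s\<close> restricted to \<open>X n\<close>, which
  vanishes in the limit by absolute continuity, whatever the vectors \<open>f n\<close> in the unit
  ball are.\<close>

lemma (in finite_measure) proj_weakly_null:
  assumes s: "s \<in> L2 M" and f: "\<And>n. f n \<in> L2 M" "\<And>n. L2_norm M (f n) \<le> 1"
    and X: "\<And>n. X n \<in> sets M" and lim: "(\<lambda>n. measure M (X n)) \<longlonglongrightarrow> 0"
  shows "(\<lambda>n. \<integral>x. inner (s x) (proj (X n) (f n) x) \<partial>M) \<longlonglongrightarrow> 0"
proof (rule tendsto_rabs_zero_cancel, rule tendsto_sandwich[OF _ _ tendsto_const])
  show "\<forall>\<^sub>F n in sequentially. 0 \<le> \<bar>\<integral>x. inner (s x) (proj (X n) (f n) x) \<partial>M\<bar>" by simp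
  have "(\<lambda>n. sqrt (\<integral>x. indicator (X n) x * (cmod (s x))\<^sup>2 \<partial>M)) \<longlonglongrightarrow> sqrt 0"
    by (intro tendsto_real_sqrt integral_indicator_tendsto_0 L2_integrable s X lim) auto
  moreover have "sqrt (\<integral>x. indicator (X n) x * (cmod (s x))\<^sup>2 \<partial>M) = L2_norm M (proj (X n) s)" for n
    using L2_norm_proj[OF s X, of n] by (metis L2_norm_nonneg real_sqrt_unique)
  ultimately show "(\<lambda>n. L2_norm M (proj (X n) s)) \<longlonglongrightarrow> 0" by simp
  have "\<bar>\<integral>x. inner (s x) (proj (X n) (f n) x) \<partial>M\<bar> \<le> L2_norm M (proj (X n) s)" for n
  proof -
    have "inner (s x) (proj (X n) (f n) x) = inner (proj (X n) s x) (f n x)" for x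
      by (simp add: proj_def indicator_def)
    then have "\<bar>\<integral>x. inner (s x) (proj (X n) (f n) x) \<partial>M\<bar> \<le> L2_norm M (proj (X n) s) * L2_norm M (f n)"
      using L2_Cauchy_Schwarz[OF L2_proj[OF s X] f(1)] by simp
    also have "\<dots> \<le> L2_norm M (proj (X n) s)"
      using f(2) by (simp add: mult_left_le L2_norm_nonneg)
    finally show ?thesis .
  qed
  then show "\<forall>\<^sub>F n in sequentially.
      \<bar>\<integral>x. inner (s x) (proj (X n) (f n) x) \<partial>M\<bar> \<le> L2_norm M (proj (X n) s)"
    by simp
qed

section \<open>Bounded operators, and compact operators on sets of small measure\<close>

lemma bounded_opD:
  assumes "bounded_op M W"
  shows "\<And>f. f \<in> L2 M \<Longrightarrow> W f \<in> L2 M"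
    and "\<And>f g. f \<in> L2 M \<Longrightarrow> g \<in> L2 M \<Longrightarrow> AE x in M. W (\<lambda>y. f y + g y) x = W f x + W g x"
    and "\<And>c f. f \<in> L2 M \<Longrightarrow> AE x in M. W (\<lambda>y. c * f y) x = c * W f x"
  using assms by (auto simp: bounded_op_def linear_op_def)

text \<open>A nonnegative constant permits the estimate \<open>K * t \<le> K\<close> for
  \<open>t \<le> 1\<close>. Passing to \<open>max K 0\<close> keeps the bound because norms are
  nonnegative.\<close>

lemma bounded_op_bound:
  assumes "bounded_op M W"
  obtains K where "K \<ge> 0" "\<And>f. f \<in> L2 M \<Longrightarrow> L2_norm M (W f) \<le> K * L2_norm M f"
proof -
  obtain K where K: "\<And>f. f \<in> L2 M \<Longrightarrow> L2_norm M (W f) \<le> K * L2_norm M f"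
    using assms by (auto simp: bounded_op_def)
  have "L2_norm M (W f) \<le> max K 0 * L2_norm M f" if "f \<in> L2 M" for f
    using K[OF that] mult_right_mono[of K "max K 0" "L2_norm M f"]
    by (simp add: L2_norm_nonneg)
  then show ?thesis by (intro that[of "max K 0"]) auto
qed

text \<open>
  Otherwise there are vectors \<open>h n\<close> of norm at most 1 supported on sets of measure
  tending to 0, hence weakly null, whose images (along a subsequence) approach some \<open>g\<close> of positive
  norm. A sum \<open>s\<close> of \<open>N\<close> nearly orthogonal terms then has norm at most \<open>sqrt (2 * N)\<close>, while \<open>V s\<close> is close to \<open>N * g\<close>.
\<close>
lemma (in finite_measure) compact_op_small_sets:
  assumes V: "compact_op M V" and "e > 0"
  shows "\<exists>d>0. \<forall>X\<in>sets M. measure M X < d \<longrightarrow>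
    (\<forall>f\<in>L2 M. L2_norm M f \<le> 1 \<longrightarrow> L2_norm M (V (proj X f)) \<le> e)"
proof (rule ccontr)
  assume contra: "\<not> ?thesis"
  have "\<exists>X f. X \<in> sets M \<and> measure M X < inverse (Suc n) \<and> f \<in> L2 M \<and> L2_norm M f \<le> 1
      \<and> e < L2_norm M (V (proj X f))" for n
  proof -
    have "inverse (real (Suc n)) > 0" by simp
    with contra show ?thesis by (meson not_le)
  qed
  then obtain X f where X: "\<And>n. X n \<in> sets M" and mX: "\<And>n. measure M (X n) < inverse (Suc n)"
    and f: "\<And>n. f n \<in> L2 M" "\<And>n. L2_norm M (f n) \<le> 1"
    and large: "\<And>n. e < L2_norm M (V (proj (X n) (f n)))"
    by metis
  define h where "h n = proj (X n) (f n)" for n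
  have h: "h n \<in> L2 M" "L2_norm M (h n) \<le> 1" for n
    using L2_proj[OF f(1) X] L2_norm_proj_le[OF f(1) X] f(2) order_trans
    unfolding h_def by blast+
  obtain r g where g: "g \<in> L2 M" and r: "strict_mono r"
    and conv: "(\<lambda>n. L2_norm M (\<lambda>x. V (h (r n)) x - g x)) \<longlonglongrightarrow> 0"
    using V h unfolding compact_op_def by blast
  have Vb: "bounded_op M V" using V by (simp add: compact_op_def)
  note Vd = bounded_opD[OF Vb]
  obtain K where K: "K \<ge> 0" "\<And>f. f \<in> L2 M \<Longrightarrow> L2_norm M (V f) \<le> K * L2_norm M f"
    using bounded_op_bound[OF Vb] by blast
  have mlim: "(\<lambda>n. measure M (X n)) \<longlonglongrightarrow> 0"
    by (rule tendsto_sandwich[OF _ _ tendsto_const LIMSEQ_inverse_real_of_nat])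
       (use mX in \<open>auto intro!: always_eventually less_imp_le\<close>)
  have weak: "(\<lambda>n. \<integral>x. inner (s x) (h (r n) x) \<partial>M) \<longlonglongrightarrow> 0" if "s \<in> L2 M" for s
    using LIMSEQ_subseq_LIMSEQ[OF proj_weakly_null[OF that f X mlim] r]
    by (simp add: h_def o_def)
  \<comment> \<open>The fraction 1/4 is chosen so that e - 2 * \<open>\<eta>\<close> is e / 2: one
    \<open>\<eta>\<close> is lost in bounding the norm of \<open>g\<close> from below, the other in
    each summand of \<open>V s\<close>.\<close>
  define \<eta> where "\<eta> = e / 4"
  have "\<eta> > 0" using \<open>e > 0\<close> by (simp add: \<eta>_def)
  have close: "eventually (\<lambda>n. L2_norm M (\<lambda>x. V (h (r n)) x - g x) < \<eta>) sequentially"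
    using conv \<open>\<eta> > 0\<close> by (rule order_tendstoD)
  \<comment> \<open>Each new term raises the squared norm by at most 2: at most 1 from the term
    itself and less than 1 from twice the inner product with the previous sum, which weak
    convergence makes smaller than 1/2.\<close>
  have sums: "\<exists>s\<in>L2 M. (L2_norm M s)\<^sup>2 \<le> 2 * real N
      \<and> L2_norm M (\<lambda>x. V s x - of_real (real N) * g x) \<le> real N * \<eta>" for N
  proof (induction N)
    case 0
    have "L2_norm M (V (\<lambda>x. 0)) = 0"
      using K(2)[OF L2_zero] L2_norm_nonneg[of M "V (\<lambda>x. 0)"] by (simp add: L2_norm_zero)
    then show ?case by (intro bexI[of _ "\<lambda>x. 0"]) (auto simp: L2_zero L2_norm_zero)
  next
    case (Suc N)
    then obtain s where s: "s \<in> L2 M" "(L2_norm M s)\<^sup>2 \<le> 2 * real N"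
      "L2_norm M (\<lambda>x. V s x - of_real (real N) * g x) \<le> real N * \<eta>" by blast
    have "eventually (\<lambda>n. (\<integral>x. inner (s x) (h (r n) x) \<partial>M) < 1 / 2) sequentially"
      using weak[OF s(1)] by (rule order_tendstoD) simp
    from eventually_happens'[OF _ eventually_conj[OF this close]]
    obtain n where n: "(\<integral>x. inner (s x) (h (r n) x) \<partial>M) < 1 / 2"
      "L2_norm M (\<lambda>x. V (h (r n)) x - g x) < \<eta>" by auto
    let ?t = "\<lambda>x. s x + h (r n) x"
    have t: "?t \<in> L2 M" by (intro L2_add s h)
    have "(L2_norm M (h (r n)))\<^sup>2 \<le> 1"
      using h(2)[of "r n"] L2_norm_nonneg[of M "h (r n)"] by (simp add: power_le_one)
    then have "(L2_norm M ?t)\<^sup>2 \<le> 2 * real (Suc N)"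
      using L2_add_scale(2)[OF s(1) h(1)[of "r n"], of 1] s(2) n(1) by simp
    moreover have "L2_norm M (\<lambda>x. V ?t x - of_real (real (Suc N)) * g x) \<le> real (Suc N) * \<eta>"
    proof -
      let ?a = "\<lambda>x. V s x - of_real (real N) * g x" and ?b = "\<lambda>x. V (h (r n)) x - g x"
      have a: "?a \<in> L2 M" by (intro L2_diff L2_scale Vd s g)
      have b: "?b \<in> L2 M" by (intro L2_diff Vd h g)
      \<comment> \<open>\<open>V\<close> is additive only almost everywhere, so the two functions
        are compared through their norms.\<close>
      have "L2_norm M (\<lambda>x. V ?t x - of_real (real (Suc N)) * g x) = L2_norm M (\<lambda>x. ?a x + ?b x)"
      proof (rule L2_norm_cong_AE)
        show "AE x in M. V ?t x - of_real (real (Suc N)) * g x = ?a x + ?b x"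
          using Vd(2)[OF s(1) h(1)[of "r n"]] by eventually_elim (simp add: algebra_simps)
      qed (intro L2_diff L2_scale Vd t g L2_add a b)+
      also have "\<dots> \<le> L2_norm M ?a + L2_norm M ?b" by (rule L2_triangle[OF a b])
      also have "\<dots> \<le> real (Suc N) * \<eta>" using s(3) n(2) by (simp add: algebra_simps)
      finally show ?thesis .
    qed
    ultimately show ?case using t by blast
  qed
  have g_large: "e - \<eta> < L2_norm M g"
  proof -
    obtain n where n: "L2_norm M (\<lambda>x. V (h (r n)) x - g x) < \<eta>"
      using eventually_happens'[OF _ close] by auto
    show ?thesis
      using L2_triangle_diff[OF Vd(1)[OF h(1)] g, of "r n"] n large[of "r n"]
      by (simp add: h_def)
  qed
  \<comment> \<open>The estimates below give (N e / 2)^2 at most 2 N K^2, that is, N e^2 at most 8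
    K^2; this choice of \<open>N\<close> contradicts that.\<close>
  obtain N :: nat where N: "8 * K\<^sup>2 / e\<^sup>2 < real N" using reals_Archimedean2 by blast
  then have "N > 0"
    by (metis divide_nonneg_nonneg gr0I mult_nonneg_nonneg not_less of_nat_0 zero_le_numeral
        zero_le_power2)
  obtain s where s: "s \<in> L2 M" "(L2_norm M s)\<^sup>2 \<le> 2 * real N"
    "L2_norm M (\<lambda>x. V s x - of_real (real N) * g x) \<le> real N * \<eta>" using sums by blast
  have "real N * L2_norm M g \<le> L2_norm M (\<lambda>x. V s x - of_real (real N) * g x) + L2_norm M (V s)"
    using L2_triangle_diff[OF L2_scale[OF g, of "real N"] Vd(1)[OF s(1)]]
    by (simp only: L2_norm_scale L2_norm_minus_commute[of M "V s"])
  also have "\<dots> \<le> real N * \<eta> + K * L2_norm M s"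
    using s(3) K(2)[OF s(1)] by simp
  finally have "real N * (e / 2) \<le> K * L2_norm M s"
    using mult_left_mono[OF less_imp_le[OF g_large], of "real N"]
    by (simp add: \<eta>_def algebra_simps)
  then have "(real N * (e / 2))\<^sup>2 \<le> (K * L2_norm M s)\<^sup>2"
    using \<open>e > 0\<close> by (intro power_mono) auto
  also have "\<dots> \<le> K\<^sup>2 * (2 * real N)"
    unfolding power_mult_distrib by (intro mult_left_mono s) auto
  finally have "real N * (real N * e\<^sup>2) \<le> real N * (8 * K\<^sup>2)"
    by (simp add: power2_eq_square algebra_simps)
  then have "real N * e\<^sup>2 \<le> 8 * K\<^sup>2" using \<open>N > 0\<close> by simp
  then show False using N \<open>e > 0\<close> by (simp add: field_simps)
qed

section \<open>Sums of operators and operator norms on pieces\<close>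

lemma bounded_op_op_plus:
  assumes W: "bounded_op M W" and V: "bounded_op M V"
  shows "bounded_op M (op_plus W V)"
proof -
  note Wd = bounded_opD[OF W] and Vd = bounded_opD[OF V]
  obtain K where K: "\<And>f. f \<in> L2 M \<Longrightarrow> L2_norm M (W f) \<le> K * L2_norm M f"
    using bounded_op_bound[OF W] by blast
  obtain L where L: "\<And>f. f \<in> L2 M \<Longrightarrow> L2_norm M (V f) \<le> L * L2_norm M f"
    using bounded_op_bound[OF V] by blast
  have "L2_norm M (op_plus W V f) \<le> (K + L) * L2_norm M f" if "f \<in> L2 M" for f
    using L2_triangle[OF Wd(1)[OF that] Vd(1)[OF that]] K[OF that] L[OF that]
    by (simp add: op_plus_def algebra_simps)
  moreover have "linear_op M (op_plus W V)"
    unfolding linear_op_def op_plus_def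
  proof (intro conjI ballI allI)
    fix f g assume fg: "f \<in> L2 M" "g \<in> L2 M"
    show "AE x in M. W (\<lambda>y. f y + g y) x + V (\<lambda>y. f y + g y) x = W f x + V f x + (W g x + V g x)"
      using Wd(2)[OF fg] Vd(2)[OF fg] by eventually_elim simp
  next
    fix c f assume f: "f \<in> L2 M"
    show "AE x in M. W (\<lambda>y. c * f y) x + V (\<lambda>y. c * f y) x = c * (W f x + V f x)"
      using Wd(3)[OF f, of c] Vd(3)[OF f, of c] by eventually_elim (simp add: algebra_simps)
  qed (intro L2_add Wd Vd)
  ultimately show ?thesis unfolding bounded_op_def by blast
qed

lemma op_norm_le:
  assumes "\<And>f. f \<in> L2 M \<Longrightarrow> L2_norm M f \<le> 1 \<Longrightarrow> L2_norm M (W f) \<le> B"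
  shows "op_norm M W \<le> B"
  unfolding op_norm_def
proof (rule cSUP_least)
  show "{f \<in> L2 M. L2_norm M f \<le> 1} \<noteq> {}"
    using L2_zero[of M] L2_norm_zero[of M] by auto
qed (use assms in auto)

text \<open>\<open>op_norm\<close> is a supremum of reals and dominates its members only once these
  are bounded above. A bound for \<open>W\<close> serves, since \<open>proj X\<close> does not
  increase norms.\<close>

lemma L2_norm_le_op_norm_proj:
  assumes W: "bounded_op M W" and X: "X \<in> sets M" and f: "f \<in> L2 M" "L2_norm M f \<le> 1"
  shows "L2_norm M (W (proj X f)) \<le> op_norm M (W \<circ> proj X)"
proof -
  obtain K where K: "K \<ge> 0" "\<And>f. f \<in> L2 M \<Longrightarrow> L2_norm M (W f) \<le> K * L2_norm M f"
    using bounded_op_bound[OF W] by blast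
  have "L2_norm M (W (proj X g)) \<le> K" if "g \<in> L2 M" "L2_norm M g \<le> 1" for g
    using K(2)[OF L2_proj[OF that(1) X]] L2_norm_proj_le[OF that(1) X] that(2) K(1)
    by (meson mult_left_le order_trans)
  then have "bdd_above ((\<lambda>f. L2_norm M ((W \<circ> proj X) f)) ` {f \<in> L2 M. L2_norm M f \<le> 1})"
    by (auto intro!: bdd_aboveI[of _ K])
  from cSUP_upper[OF _ this, of f] show ?thesis
    using f by (simp add: op_norm_def)
qed

lemma op_norm_proj_nonneg:
  assumes "bounded_op M W" "X \<in> sets M"
  shows "0 \<le> op_norm M (W \<circ> proj X)"
  by (rule order_trans[OF L2_norm_nonneg L2_norm_le_op_norm_proj[OF assms L2_zero]])
     (simp add: L2_norm_zero)

text \<open>A vector supported on \<open>X\<close> is fixed by \<open>proj Y\<close>, so on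
  \<open>X\<close> the norm of \<open>W\<close> is controlled by its norm on the larger set
  \<open>Y\<close>.\<close>

lemma op_norm_op_plus_proj_le:
  assumes W: "bounded_op M W" and V: "bounded_op M V"
    and sets: "X \<in> sets M" "Y \<in> sets M" and "X \<subseteq> Y"
    and e: "\<And>f. f \<in> L2 M \<Longrightarrow> L2_norm M f \<le> 1 \<Longrightarrow> L2_norm M (V (proj X f)) \<le> e"
  shows "op_norm M (op_plus W V \<circ> proj X) \<le> op_norm M (W \<circ> proj Y) + e"
proof (rule op_norm_le)
  fix f assume f: "f \<in> L2 M" "L2_norm M f \<le> 1"
  have p: "proj X f \<in> L2 M" "L2_norm M (proj X f) \<le> 1"
    using L2_proj[OF f(1) sets(1)] L2_norm_proj_le[OF f(1) sets(1)] f(2) by auto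
  have pp: "proj Y (proj X f) = proj X f"
    using \<open>X \<subseteq> Y\<close> by (auto simp: proj_def indicator_def fun_eq_iff)
  have "L2_norm M ((op_plus W V \<circ> proj X) f) \<le> L2_norm M (W (proj X f)) + L2_norm M (V (proj X f))"
    unfolding op_plus_def o_def by (intro L2_triangle bounded_opD(1)[OF W] bounded_opD(1)[OF V] p)
  also have "\<dots> \<le> op_norm M (W \<circ> proj Y) + e"
    using L2_norm_le_op_norm_proj[OF W sets(2) p] e[OF f] by (simp add: pp)
  finally show "L2_norm M ((op_plus W V \<circ> proj X) f) \<le> op_norm M (W \<circ> proj Y) + e" .
qed

section \<open>Upper bounds for the mu-norm from finite families\<close>

text \<open>Frees partitions from the index set \<open>{1..J}\<close>, so that a common refinement
  can be indexed by pairs. The family is transported along a bijection.\<close>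

lemma mu_norm_le_family:
  assumes I: "finite I" and Z: "\<And>i. i \<in> I \<Longrightarrow> Z i \<in> sets M"
    and cover: "measure M (space M - (\<Union>i\<in>I. Z i)) = 0"
    and null: "\<And>i k. i \<in> I \<Longrightarrow> k \<in> I \<Longrightarrow> i \<noteq> k \<Longrightarrow> measure M (Z i \<inter> Z k) = 0"
  shows "mu_norm M V \<le> sqrt (\<Sum>i\<in>I. measure M (Z i) * (op_norm M (V \<circ> proj (Z i)))\<^sup>2)"
proof -
  obtain b where b: "bij_betw b {1..card I} I"
    using ex_bij_betw_nat_finite_1[OF I] by blast
  have im: "b ` {1..card I} = I" and bI: "\<And>j. j \<in> {1..card I} \<Longrightarrow> b j \<in> I"
    using b by (auto simp: bij_betw_def)
  have "is_partition M (card I) (Z \<circ> b)"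
    unfolding is_partition_def
  proof (intro conjI ballI impI)
    show "measure M (space M - (\<Union>j\<in>{1..card I}. (Z \<circ> b) j)) = 0"
      using cover by (simp only: image_comp[symmetric] im)
  next
    fix j k assume jk: "j \<in> {1..card I}" "k \<in> {1..card I}" "j \<noteq> k"
    then have "b j \<noteq> b k" using bij_betw_imp_inj_on[OF b] by (metis inj_on_eq_iff)
    then show "measure M ((Z \<circ> b) j \<inter> (Z \<circ> b) k) = 0"
      unfolding o_apply by (rule null[OF bI[OF jk(1)] bI[OF jk(2)]])
  next
    fix j assume "j \<in> {1..card I}"
    then show "(Z \<circ> b) j \<in> sets M" unfolding o_apply by (intro Z bI)
  qed
  moreover have "partition_sum M (card I) (Z \<circ> b) V
      = (\<Sum>i\<in>I. measure M (Z i) * (op_norm M (V \<circ> proj (Z i)))\<^sup>2)"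
    unfolding partition_sum_def
    using sum.reindex_bij_betw[OF b, of "\<lambda>i. measure M (Z i) * (op_norm M (V \<circ> proj (Z i)))\<^sup>2"]
    by simp
  moreover have "mu_norm M V \<le> sqrt (partition_sum M (card I) (Z \<circ> b) V)"
    unfolding mu_norm_def
  proof (rule cInf_lower)
    show "bdd_below {sqrt (partition_sum M J Y V) | J Y. is_partition M J Y}"
      by (rule bdd_belowI[of _ 0]) (auto simp: partition_sum_def intro!: sum_nonneg)
  qed (use calculation(1) in blast)
  ultimately show ?thesis by simp
qed

section \<open>Fine partitions of a measure without atoms\<close>

text \<open>When a set is split into two parts of positive measure, one of them has at most half its
  measure; this is iterated.\<close>

lemma (in finite_measure) no_atoms_small_subset:
  assumes na: "no_atoms M" and X: "X \<in> sets M" "0 < measure M X" and "0 < d"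
  shows "\<exists>Y\<in>sets M. Y \<subseteq> X \<and> 0 < measure M Y \<and> measure M Y < d"
proof -
  have halve: "\<exists>Y\<in>sets M. Y \<subseteq> X \<and> 0 < measure M Y \<and> measure M Y \<le> measure M X / 2 ^ n" for n
  proof (induction n)
    case 0
    then show ?case using X by auto
  next
    case (Suc n)
    then obtain Y where Y: "Y \<in> sets M" "Y \<subseteq> X" "0 < measure M Y" "measure M Y \<le> measure M X / 2 ^ n"
      by blast
    then obtain Z where Z: "Z \<in> sets M" "Z \<subseteq> Y" "0 < measure M Z" "measure M Z < measure M Y"
      using na unfolding no_atoms_def by blast
    have diff: "measure M (Y - Z) = measure M Y - measure M Z"
      using Y Z by (simp add: finite_measure_Diff)
    show ?case
    proof (cases "measure M Z \<le> measure M Y / 2")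
      case True
      then show ?thesis using Y Z by (intro bexI[of _ Z]) auto
    next
      case False
      then show ?thesis using Y Z diff by (intro bexI[of _ "Y - Z"]) auto
    qed
  qed
  have "eventually (\<lambda>n. measure M X / 2 ^ n < d) sequentially"
    using \<open>0 < d\<close> by real_asymp
  then obtain n where "measure M X / 2 ^ n < d"
    by (auto simp: eventually_sequentially)
  with halve[of n] show ?thesis by (meson le_less_trans)
qed

text \<open>An exhaustion argument on the class \<open>G\<close> of finite unions of small sets. If
  members of \<open>G\<close> whose measures approach the supremum missed a set of positive measure,
  a small subset of it could be added to one of them and exceed the supremum. Hence finitely many of
  them leave a remainder of measure less than \<open>d\<close>. That remainder is itself small, so
  the whole space lies in \<open>G\<close>, and the small sets covering it can be made
  disjoint.\<close>

lemma (in finite_measure) no_atoms_partition: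
  assumes na: "no_atoms M" and "0 < d"
  shows "\<exists>(B :: nat \<Rightarrow> 'a set) n. range B \<subseteq> {A \<in> sets M. measure M A < d}
    \<and> disjoint_family B \<and> (\<Union>i<n. B i) = space M"
proof -
  define G where "G = {A. \<exists>F. finite F \<and> F \<subseteq> {Y \<in> sets M. measure M Y < d} \<and> A = \<Union>F}"
  have G_sets: "A \<in> sets M" if "A \<in> G" for A
    using that unfolding G_def by auto
  have G_Un: "A \<union> A' \<in> G" if "A \<in> G" "A' \<in> G" for A A'
  proof -
    from that(1) obtain F where "finite F" "F \<subseteq> {Y \<in> sets M. measure M Y < d}" "A = \<Union>F"
      unfolding G_def by auto
    moreover from that(2) obtain F' where "finite F'" "F' \<subseteq> {Y \<in> sets M. measure M Y < d}" "A' = \<Union>F'"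
      unfolding G_def by auto
    ultimately show ?thesis unfolding G_def by (intro CollectI exI[of _ "F \<union> F'"]) auto
  qed
  have G_small: "Y \<in> G" if "Y \<in> sets M" "measure M Y < d" for Y
    using that unfolding G_def by (intro CollectI exI[of _ "{Y}"]) auto
  have G_empty: "{} \<in> G" by (rule G_small) (use \<open>0 < d\<close> in auto)
  define s where "s = (SUP A\<in>G. measure M A)"
  have bdd: "bdd_above (measure M ` G)"
    by (intro bdd_aboveI[of _ "measure M (space M)"]) (auto simp: bounded_measure)
  have G_le: "measure M A \<le> s" if "A \<in> G" for A
    unfolding s_def using that bdd by (rule cSUP_upper)
  have "\<exists>A\<in>G. s - inverse (real (Suc n)) < measure M A" for n
  proof -
    have "s - inverse (real (Suc n)) < (SUP A\<in>G. measure M A)" unfolding s_def[symmetric] by simp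
    then show ?thesis using less_cSUP_iff[OF _ bdd] G_empty by blast
  qed
  then obtain A where A: "\<And>n. A n \<in> G" "\<And>n. s - inverse (real (Suc n)) < measure M (A n)" by metis
  note As = G_sets[OF A(1)]
  have full: "measure M (space M - (\<Union>n. A n)) = 0"
  proof (rule ccontr)
    assume "measure M (space M - (\<Union>n. A n)) \<noteq> 0"
    then have "0 < measure M (space M - (\<Union>n. A n))" using zero_less_measure_iff by blast
    then obtain Y where Y: "Y \<in> sets M" "Y \<subseteq> space M - (\<Union>n. A n)" "0 < measure M Y" "measure M Y < d"
      using no_atoms_small_subset[OF na _ _ \<open>0 < d\<close>, of "space M - (\<Union>n. A n)"] As by blast
    obtain n where n: "inverse (real (Suc n)) < measure M Y" using reals_Archimedean[OF Y(3)] by blast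
    have "measure M (A n \<union> Y) = measure M (A n) + measure M Y"
      using Y As by (intro finite_measure_Union) auto
    then show False using G_le[OF G_Un[OF A(1) G_small[OF Y(1,4)], of n]] A(2)[of n] n by simp
  qed
  have "(\<lambda>n. measure M (\<Union>i\<le>n. A i)) \<longlonglongrightarrow> measure M (\<Union>n. \<Union>i\<le>n. A i)"
  proof (rule finite_Lim_measure_incseq)
    show "range (\<lambda>n. \<Union>i\<le>n. A i) \<subseteq> sets M" using As by auto
    show "incseq (\<lambda>n. \<Union>i\<le>n. A i)" by (rule incseq_SucI) (auto simp: atMost_Suc)
  qed
  moreover have "(\<Union>n. \<Union>i\<le>n. A i) = (\<Union>n. A n)" by auto
  moreover have "measure M (\<Union>n. A n) = measure M (space M)"
  proof -
    have "(\<Union>n. A n) \<in> sets M" using As by blast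
    from finite_measure_compl[OF this] show ?thesis using full by simp
  qed
  ultimately have "(\<lambda>n. measure M (\<Union>i\<le>n. A i)) \<longlonglongrightarrow> measure M (space M)" by simp
  then have "eventually (\<lambda>n. measure M (space M) - d < measure M (\<Union>i\<le>n. A i)) sequentially"
    using \<open>0 < d\<close> by (intro order_tendstoD) auto
  then obtain n where n: "measure M (space M) - d < measure M (\<Union>i\<le>n. A i)"
    by (auto simp: eventually_sequentially)
  have U: "(\<Union>i\<le>n. A i) \<in> G" for n
    by (induction n) (simp_all add: A(1) atMost_Suc G_Un)
  have "space M - (\<Union>i\<le>n. A i) \<in> G"
  proof (rule G_small)
    show "space M - (\<Union>i\<le>n. A i) \<in> sets M" using G_sets[OF U] by blast
    show "measure M (space M - (\<Union>i\<le>n. A i)) < d"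
      using n finite_measure_compl[OF G_sets[OF U[of n]]] by simp
  qed
  then have "(\<Union>i\<le>n. A i) \<union> (space M - (\<Union>i\<le>n. A i)) \<in> G" by (intro G_Un U)
  moreover have "(\<Union>i\<le>n. A i) \<union> (space M - (\<Union>i\<le>n. A i)) = space M"
    using sets.sets_into_space[OF G_sets[OF U[of n]]] by blast
  ultimately obtain F where F: "finite F" "F \<subseteq> {Y \<in> sets M. measure M Y < d}" "space M = \<Union>F"
    unfolding G_def by auto
  obtain xs where xs: "set xs = F" using finite_list[OF F(1)] by blast
  \<comment> \<open>Padding with the empty set, which is small because \<open>d > 0\<close>, turns
    the list into a sequence to which \<open>disjointed\<close> applies.\<close>
  define C where "C i = (if i < length xs then xs ! i else {})" for i
  have C: "C i \<in> sets M" "measure M (C i) < d" for i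
    using F(2) xs \<open>0 < d\<close> nth_mem[of i xs] unfolding C_def by auto
  have "(\<Union>i<length xs. C i) = \<Union>F"
    unfolding xs[symmetric] C_def by (auto simp: set_conv_nth)
  then have "(\<Union>i<length xs. disjointed C i) = space M"
    using finite_UN_disjointed_eq[of C "length xs"] F(3) by (simp add: atLeast0LessThan)
  moreover have "disjointed C i \<in> sets M" for i
    using sets.range_disjointed_sets[of C M] C(1) by blast
  moreover have "measure M (disjointed C i) < d" for i
    using finite_measure_mono[OF disjointed_subset[of C i] C(1)] C(2)[of i] by simp
  ultimately show ?thesis
    using disjoint_family_disjointed[of C] by blast
qed

section \<open>Compact perturbations do not increase the mu-norm\<close>

text \<open>
  Intersect a partition for \<open>W\<close> with one into sets so small that \<open>V\<close> has norm at most \<open>e\<close> on each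
  of them: on the piece \<open>Y j \<inter> B k\<close> the norm of \<open>W + V\<close> exceeds that of \<open>W\<close> on \<open>Y j\<close> by at most \<open>e\<close>.
\<close>
lemma mu_norm_op_plus_compact_le:
  assumes "prob_space M" and na: "no_atoms M"
    and W: "bounded_op M W" and V: "compact_op M V"
  shows "mu_norm M (op_plus W V) \<le> mu_norm M W"
proof -
  interpret prob_space M by fact
  have Vb: "bounded_op M V" using V by (simp add: compact_op_def)
  have step: "mu_norm M (op_plus W V) \<le> sqrt (partition_sum M J Y W)"
    if P: "is_partition M J Y" for J Y
  proof -
    define a where "a j = op_norm M (W \<circ> proj (Y j))" for j
    have Y: "Y j \<in> sets M" if "j \<in> {1..J}" for j
      using P that by (simp add: is_partition_def)
    have approx: "mu_norm M (op_plus W V) \<le> sqrt (\<Sum>j=1..J. measure M (Y j) * (a j + e)\<^sup>2)"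
      if "e > 0" for e
    proof -
      obtain d where "d > 0" and d: "\<And>X f. X \<in> sets M \<Longrightarrow> measure M X < d \<Longrightarrow> f \<in> L2 M \<Longrightarrow>
          L2_norm M f \<le> 1 \<Longrightarrow> L2_norm M (V (proj X f)) \<le> e"
        using compact_op_small_sets[OF V \<open>e > 0\<close>] by blast
      obtain B :: "nat \<Rightarrow> 'a set" and n where B_small: "range B \<subseteq> {A \<in> sets M. measure M A < d}"
        and B_disj: "disjoint_family B" and B_cover: "(\<Union>i<n. B i) = space M"
        using no_atoms_partition[OF na \<open>d > 0\<close>] by blast
      have B: "B i \<in> sets M" "measure M (B i) < d" for i
        using B_small by blast+
      define I where "I = {1..J} \<times> {..<n}"
      define Z where "Z = (\<lambda>(j, k). Y j \<inter> B k)"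
      have bound: "op_norm M (op_plus W V \<circ> proj (Y j \<inter> B k)) \<le> a j + e" if "j \<in> {1..J}" for j k
        unfolding a_def
      proof (rule op_norm_op_plus_proj_le[OF W Vb])
        have "measure M (Y j \<inter> B k) < d"
          using finite_measure_mono[of "Y j \<inter> B k" "B k"] B[of k] by simp
        then show "L2_norm M (V (proj (Y j \<inter> B k) f)) \<le> e" if "f \<in> L2 M" "L2_norm M f \<le> 1" for f
          using d[OF sets.Int[OF Y[OF \<open>j \<in> {1..J}\<close>] B(1)] _ that] by blast
      qed (use Y[OF that] B(1) in auto)
      have Wp: "bounded_op M (op_plus W V)" by (rule bounded_op_op_plus[OF W Vb])
      have meas: "measure M (Y j) = (\<Sum>k<n. measure M (Y j \<inter> B k))" if "j \<in> {1..J}" for j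
      proof -
        have "Y j = (\<Union>k<n. Y j \<inter> B k)"
          using sets.sets_into_space[OF Y[OF that]] B_cover by blast
        moreover have "measure M (\<Union>k<n. Y j \<inter> B k) = (\<Sum>k<n. measure M (Y j \<inter> B k))"
          using B(1) B_disj Y[OF that]
          by (intro finite_measure_finite_Union) (auto simp: disjoint_family_on_def)
        ultimately show ?thesis by metis
      qed
      have "mu_norm M (op_plus W V)
          \<le> sqrt (\<Sum>i\<in>I. measure M (Z i) * (op_norm M (op_plus W V \<circ> proj (Z i)))\<^sup>2)"
      proof (rule mu_norm_le_family)
        have "(\<Union>i\<in>I. Z i) = (\<Union>j\<in>{1..J}. Y j) \<inter> (\<Union>k<n. B k)"
          unfolding I_def Z_def by auto
        also have "\<dots> = (\<Union>j\<in>{1..J}. Y j)"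
          unfolding B_cover using sets.sets_into_space[OF Y] by blast
        finally show "measure M (space M - (\<Union>i\<in>I. Z i)) = 0"
          using P by (simp add: is_partition_def)
      next
        fix i i' assume ii': "i \<in> I" "i' \<in> I" "i \<noteq> i'"
        obtain j k where i: "i = (j, k)" "j \<in> {1..J}" using ii'(1) unfolding I_def by blast
        obtain j' k' where i': "i' = (j', k')" "j' \<in> {1..J}" using ii'(2) unfolding I_def by blast
        \<comment> \<open>Pieces of the same \<open>Y j\<close> are disjoint because the sets
          \<open>B k\<close> are; pieces of different ones meet only inside a null set.\<close>
        show "measure M (Z i \<inter> Z i') = 0"
        proof (cases "j = j'")
          case True
          then have "B k \<inter> B k' = {}" using i i' ii'(3) B_disj by (auto simp: disjoint_family_on_def)
          then have "Z i \<inter> Z i' = {}" using i i' by (auto simp: Z_def)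
          then show ?thesis by simp
        next
          case False
          then have "measure M (Y j \<inter> Y j') = 0" using P i i' by (simp add: is_partition_def)
          moreover have "measure M (Z i \<inter> Z i') \<le> measure M (Y j \<inter> Y j')"
            using i i' Y by (intro finite_measure_mono) (auto simp: Z_def)
          ultimately show ?thesis by (simp add: measure_le_0_iff)
        qed
      qed (auto simp: I_def Z_def Y B(1))
      \<comment> \<open>Monotonicity of the square requires the operator norms on the left to be
        nonnegative.\<close>
      also have "\<dots> \<le> sqrt (\<Sum>i\<in>I. measure M (Z i) * (a (fst i) + e)\<^sup>2)"
        by (intro real_sqrt_le_mono sum_mono mult_left_mono power_mono)
           (auto simp: I_def Z_def bound Y B(1) intro!: op_norm_proj_nonneg[OF Wp])
      also have "(\<Sum>i\<in>I. measure M (Z i) * (a (fst i) + e)\<^sup>2)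
          = (\<Sum>j=1..J. \<Sum>k<n. measure M (Y j \<inter> B k) * (a j + e)\<^sup>2)"
        unfolding I_def sum.cartesian_product by (simp add: Z_def case_prod_beta)
      also have "\<dots> = (\<Sum>j=1..J. measure M (Y j) * (a j + e)\<^sup>2)"
        by (intro sum.cong refl) (simp only: meas sum_distrib_right)
      finally show ?thesis .
    qed
    \<comment> \<open>The partition \<open>Y\<close> stays fixed while e tends to 0; the refining
      sets depend on e but have left the bound.\<close>
    have "((\<lambda>e. sqrt (\<Sum>j=1..J. measure M (Y j) * (a j + e)\<^sup>2))
        \<longlongrightarrow> sqrt (\<Sum>j=1..J. measure M (Y j) * (a j + 0)\<^sup>2)) (at_right 0)"
      by (intro tendsto_intros)
    moreover have "eventually (\<lambda>e. mu_norm M (op_plus W V)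
        \<le> sqrt (\<Sum>j=1..J. measure M (Y j) * (a j + e)\<^sup>2)) (at_right 0)"
      using eventually_at_right_less[of "0::real"] by eventually_elim (rule approx)
    ultimately have "mu_norm M (op_plus W V) \<le> sqrt (\<Sum>j=1..J. measure M (Y j) * (a j + 0)\<^sup>2)"
      by (rule tendsto_lowerbound) simp
    then show ?thesis by (simp add: partition_sum_def a_def)
  qed
  \<comment> \<open>The infimum runs over a nonempty set, as \<open>cInf_greatest\<close>
    requires.\<close>
  have "is_partition M 1 (\<lambda>_. space M)" by (simp add: is_partition_def)
  then have "{sqrt (partition_sum M J Y W) | J Y. is_partition M J Y} \<noteq> {}" by blast
  then show ?thesis
    unfolding mu_norm_def[of M W]
  proof (rule cInf_greatest)
    fix x assume "x \<in> {sqrt (partition_sum M J Y W) | J Y. is_partition M J Y}"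
    then obtain J Y where "x = sqrt (partition_sum M J Y W)" "is_partition M J Y" by blast
    then show "mu_norm M (op_plus W V) \<le> x" using step by metis
  qed
qed

text \<open>Needed to undo the perturbation in the reverse inequality. The same subsequence works,
  with limit \<open>- g\<close>.\<close>

lemma compact_op_uminus:
  assumes V: "compact_op M V"
  shows "compact_op M (\<lambda>f x. - V f x)"
proof -
  have Vb: "bounded_op M V" using V by (simp add: compact_op_def)
  note Vd = bounded_opD[OF Vb]
  have "linear_op M (\<lambda>f x. - V f x)"
    unfolding linear_op_def
  proof (intro conjI ballI allI)
    fix f g assume fg: "f \<in> L2 M" "g \<in> L2 M"
    show "AE x in M. - V (\<lambda>y. f y + g y) x = - V f x + - V g x"
      using Vd(2)[OF fg] by eventually_elim simp
  next
    fix c f assume f: "f \<in> L2 M"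
    show "AE x in M. - V (\<lambda>y. c * f y) x = c * - V f x"
      using Vd(3)[OF f, of c] by eventually_elim simp
  qed (intro L2_uminus Vd)
  then have "bounded_op M (\<lambda>f x. - V f x)"
    using Vb by (simp add: bounded_op_def L2_norm_uminus)
  moreover have "\<exists>r g. g \<in> L2 M \<and> strict_mono r \<and>
      (\<lambda>n. L2_norm M (\<lambda>x. - V (f (r n)) x - g x)) \<longlonglongrightarrow> 0"
    if "\<forall>n. f n \<in> L2 M" "\<exists>C. \<forall>n. L2_norm M (f n) \<le> C" for f :: "nat \<Rightarrow> 'a \<Rightarrow> complex"
  proof -
    obtain r g where rg: "g \<in> L2 M" "strict_mono r"
      "(\<lambda>n. L2_norm M (\<lambda>x. V (f (r n)) x - g x)) \<longlonglongrightarrow> 0"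
      using V \<open>\<forall>n. f n \<in> L2 M\<close> \<open>\<exists>C. \<forall>n. L2_norm M (f n) \<le> C\<close> unfolding compact_op_def by blast
    have "L2_norm M (\<lambda>x. - V (f (r n)) x - - g x) = L2_norm M (\<lambda>x. V (f (r n)) x - g x)" for n
      using L2_norm_minus_commute[of M g "V (f (r n))"] by simp
    then show ?thesis
      using rg L2_uminus by (intro exI[of _ r] exI[of _ "\<lambda>x. - g x"]) auto
  qed
  ultimately show ?thesis unfolding compact_op_def by blast
qed

theorem corollary3p2:
  fixes M :: "'a measure" and W W\<^sub>0 :: "'a fun_op"
  assumes "prob_space M" and "no_atoms M"
    and "bounded_op M W" and "compact_op M W\<^sub>0"
  shows "mu_norm M (op_plus W W\<^sub>0) = mu_norm M W"
proof (rule antisym)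
  show "mu_norm M (op_plus W W\<^sub>0) \<le> mu_norm M W"
    by (rule mu_norm_op_plus_compact_le) fact+
  let ?V = "\<lambda>f x. - W\<^sub>0 f x"
  \<comment> \<open>An equality of functions, not merely almost everywhere, so it can be substituted
    inside \<open>mu_norm\<close>.\<close>
  have "op_plus (op_plus W W\<^sub>0) ?V = W" by (simp add: op_plus_def)
  moreover have "mu_norm M (op_plus (op_plus W W\<^sub>0) ?V) \<le> mu_norm M (op_plus W W\<^sub>0)"
    using assms by (intro mu_norm_op_plus_compact_le bounded_op_op_plus compact_op_uminus)
      (auto simp: compact_op_def)
  ultimately show "mu_norm M W \<le> mu_norm M (op_plus W W\<^sub>0)" by simp
qed

end
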